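(* Let $Y_k$ be an $m\times m$ matrix-valued (differentiable) field on $\Omega$ for a fixed direction $k$. Let $Q_r$ be a volume quadrature rule on $\Omega$ and $Q_q^{\partial\Omega}$ a face quadrature rule on $\partial\Omega$. Define, for $\alpha,\beta=1,\dots,N_p$, $$N^{(k)}_{\alpha\beta}:=Q_r[\Phi_\alpha^\top Y_k\,\partial_{x_k}\Phi_\beta],\quad V^{(k)}_{\alpha\beta}:=Q_r[\Phi_\alpha^\top(\partial_{x_k}Y_k)\Phi_\beta],\quad B^{(k)}_{\alpha\beta}:=Q_q^{\partial\Omega}[\Phi_\alpha^\top Y_k\Phi_\beta\,n_k]$$ (no summation over $k$). Suppose that: (i) for all $x,y\in(V^p)^m$, with $\psi_k:=y^\top Y_kx$, one has $Q_r[\partial_{x_k}\psi_k]=Q_q^{\partial\Omega}[\psi_kn_k]$; (ii) $Y_k(x_q)^\top=Y_k(x_q)$ at every node $x_q$ of the volume quadrature. Then the $H$–SBP identity $N^{(k)}+(N^{(k)})^\top=B^{(k)}-V^{(k)}$ holds. Consequently, if these conditions hold for every $k=1,\dots,d$, then $N+N^\top=B-V$, where $N:=\sum_kN^{(k)}$, $V:=\sum_kV^{(k)}$, $B:=\sum_kB^{(k)}$.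
   Context: $\Omega\subset\mathbb R^d$ is an element with outward unit normal $n=(n_1,\dots,n_d)$ on $\partial\Omega$. $V^p$ is the space of polynomials of degree at most $p$ on $\Omega$, $N_p=\dim V^p$, $\{\phi_\alpha\}_{\alpha=1}^{N_p}$ is an $L^2(\Omega)$-orthonormal basis of $V^p$, and $\Phi_\alpha=\phi_\alpha I_m$. Quadrature rules have positive weights and are applied componentwise to vector- and matrix-valued integrands (face rules are applied face by face on $\partial\Omega$). The arrays $N^{(k)},V^{(k)},B^{(k)}$ are block matrices with $m\times m$ blocks, and $(X^\top)_{\alpha\beta}=(X_{\beta\alpha})^\top$. *)

theory Defs
  imports "HOL-Analysis.Analysis"
begin

(* Quadrature rules: finitely many nodes with positive weights.  Applying a rule uses scaleR, so it
   acts componentwise on vector- and matrix-valued integrands. *)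

record 'a quadrature =
  nodes :: "'a set"
  weight :: "'a \<Rightarrow> real"

definition quadrature_on :: "'a set \<Rightarrow> 'a quadrature \<Rightarrow> bool" where
  "quadrature_on S Q \<longleftrightarrow>
     finite (nodes Q) \<and> nodes Q \<subseteq> S \<and> (\<forall>z\<in>nodes Q. 0 < weight Q z)"

definition quad :: "'a quadrature \<Rightarrow> ('a \<Rightarrow> 'b::real_vector) \<Rightarrow> 'b" where
  "quad Q f = (\<Sum>z\<in>nodes Q. weight Q z *\<^sub>R f z)"

(* Elements are closed, so that quadrature nodes may lie on the boundary.  The interior cone
   condition (valid for convex bodies and, more generally, for closed Lipschitz domains) excludes
   cusps; it makes derivatives within the element unique at boundary points as well. *)

definition interior_cone_condition :: "(real^'d) set \<Rightarrow> bool" where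
  "interior_cone_condition S \<longleftrightarrow>
     (\<forall>z\<in>S. \<exists>v r T. 0 < r \<and> 0 < T \<and>
        (\<forall>w\<in>ball v r. \<forall>t\<in>{0<..T}. z + t *\<^sub>R w \<in> S))"

definition outward_unit_normal :: "(real^'d) set \<Rightarrow> real^'d \<Rightarrow> real^'d \<Rightarrow> bool" where
  "outward_unit_normal S z \<nu> \<longleftrightarrow> norm \<nu> = 1 \<and>
     (\<forall>v. v \<bullet> \<nu> < 0 \<longrightarrow> (\<forall>\<^sub>F t in at_right 0. z + t *\<^sub>R v \<in> S)) \<and>
     (\<forall>v. v \<bullet> \<nu> > 0 \<longrightarrow> (\<forall>\<^sub>F t in at_right 0. z + t *\<^sub>R v \<notin> S))"

(* The normal is recorded face by face: a point shared by several faces (a vertex, an edge) has one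
   normal for each of them, obtained as the continuous extension from the part of the face that
   belongs to no other face, where the geometric normal of the element exists. *)

record 'd element =
  region :: "(real^'d) set"
  faces :: "(real^'d) set set"
  normal :: "(real^'d) set \<Rightarrow> real^'d \<Rightarrow> real^'d"

definition proper_part :: "'d element \<Rightarrow> (real^'d) set \<Rightarrow> (real^'d) set" where
  "proper_part E F = F - \<Union>(faces E - {F})"

definition is_element :: "'d::finite element \<Rightarrow> bool" where
  "is_element E \<longleftrightarrow>
     compact (region E) \<and> region E \<noteq> {} \<and> interior_cone_condition (region E) \<and>
     finite (faces E) \<and> \<Union>(faces E) = frontier (region E) \<and>
     (\<forall>F\<in>faces E. F \<noteq> {} \<and> closed F \<and> F \<subseteq> closure (proper_part E F) \<and>
        continuous_on F (normal E F) \<and>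
        (\<forall>z\<in>proper_part E F. outward_unit_normal (region E) z (normal E F z)))"

(* A face rule consists of one quadrature rule for each face.  The integrand may depend on the
   face, since the normal does. *)

definition face_quadrature_on ::
    "'d::finite element \<Rightarrow> ((real^'d) set \<Rightarrow> (real^'d) quadrature) \<Rightarrow> bool" where
  "face_quadrature_on E QF \<longleftrightarrow> (\<forall>F\<in>faces E. quadrature_on F (QF F))"

definition face_quad :: "'d::finite element \<Rightarrow> ((real^'d) set \<Rightarrow> (real^'d) quadrature) \<Rightarrow>
    ((real^'d) set \<Rightarrow> real^'d \<Rightarrow> 'b::real_vector) \<Rightarrow> 'b" where
  "face_quad E QF g = (\<Sum>F\<in>faces E. quad (QF F) (g F))"

definition partial_deriv ::
    "(real^'d) set \<Rightarrow> 'd::finite \<Rightarrow> (real^'d \<Rightarrow> 'b::real_normed_vector) \<Rightarrow> real^'d \<Rightarrow> 'b" where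
  "partial_deriv S k f z = frechet_derivative f (at z within S) (axis k 1)"

(* Polynomials are represented as functions on the whole space.  Since elements have nonempty
   interior, such a function is determined by its restriction to the element. *)

definition poly_space :: "nat \<Rightarrow> (real^'d::finite \<Rightarrow> real) set" where
  "poly_space p =
     {f. \<exists>c :: ('d \<Rightarrow> nat) \<Rightarrow> real.
           f = (\<lambda>z. \<Sum>a | (\<Sum>i\<in>UNIV. a i) \<le> p. c a * (\<Prod>i\<in>UNIV. (z $ i) ^ a i))}"

definition vec_poly_space :: "nat \<Rightarrow> (real^'d::finite \<Rightarrow> real^'m::finite) set" where
  "vec_poly_space p = {u. \<forall>i. (\<lambda>z. u z $ i) \<in> poly_space p}"

(* The index type 'n of the basis plays the role of {1..N_p}: orthonormality implies linear
   independence, so CARD('n) is the dimension of the polynomial space. *)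

definition L2_orthonormal_basis ::
    "(real^'d::finite) set \<Rightarrow> nat \<Rightarrow> ('n::finite \<Rightarrow> real^'d \<Rightarrow> real) \<Rightarrow> bool" where
  "L2_orthonormal_basis S p \<phi> \<longleftrightarrow>
     (\<forall>\<alpha>. \<phi> \<alpha> \<in> poly_space p) \<and>
     (\<forall>\<alpha> \<beta>. (LINT z:S|lebesgue. \<phi> \<alpha> z * \<phi> \<beta> z) = (if \<alpha> = \<beta> then 1 else 0)) \<and>
     (\<forall>f\<in>poly_space p. \<exists>c. \<forall>z\<in>S. f z = (\<Sum>\<alpha>\<in>UNIV. c \<alpha> * \<phi> \<alpha> z))"

definition basis_block :: "('n \<Rightarrow> real^'d \<Rightarrow> real) \<Rightarrow> 'n \<Rightarrow> real^'d \<Rightarrow> real^'m^'m" where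
  "basis_block \<phi> \<alpha> z = \<phi> \<alpha> z *\<^sub>R mat 1"

type_synonym ('m, 'n) block_matrix = "((real^'m^'m)^'n)^'n"

definition block_transpose :: "('m::finite, 'n::finite) block_matrix \<Rightarrow> ('m, 'n) block_matrix" where
  "block_transpose X = (\<chi> \<alpha> \<beta>. transpose (X $ \<beta> $ \<alpha>))"

definition N_mat :: "'d::finite element \<Rightarrow> (real^'d) quadrature \<Rightarrow> ('n::finite \<Rightarrow> real^'d \<Rightarrow> real) \<Rightarrow>
    (real^'d \<Rightarrow> real^'m^'m) \<Rightarrow> 'd \<Rightarrow> ('m::finite, 'n) block_matrix" where
  "N_mat E Q \<phi> Yk k = (\<chi> \<alpha> \<beta>. quad Q (\<lambda>z.
     transpose (basis_block \<phi> \<alpha> z) ** Yk z ** partial_deriv (region E) k (basis_block \<phi> \<beta>) z))"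

definition V_mat :: "'d::finite element \<Rightarrow> (real^'d) quadrature \<Rightarrow> ('n::finite \<Rightarrow> real^'d \<Rightarrow> real) \<Rightarrow>
    (real^'d \<Rightarrow> real^'m^'m) \<Rightarrow> 'd \<Rightarrow> ('m::finite, 'n) block_matrix" where
  "V_mat E Q \<phi> Yk k = (\<chi> \<alpha> \<beta>. quad Q (\<lambda>z.
     transpose (basis_block \<phi> \<alpha> z) ** partial_deriv (region E) k Yk z ** basis_block \<phi> \<beta> z))"

definition B_mat :: "'d::finite element \<Rightarrow> ((real^'d) set \<Rightarrow> (real^'d) quadrature) \<Rightarrow>
    ('n::finite \<Rightarrow> real^'d \<Rightarrow> real) \<Rightarrow>
    (real^'d \<Rightarrow> real^'m^'m) \<Rightarrow> 'd \<Rightarrow> ('m::finite, 'n) block_matrix" where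
  "B_mat E QF \<phi> Yk k = (\<chi> \<alpha> \<beta>. face_quad E QF (\<lambda>F z.
     (normal E F z $ k) *\<^sub>R (transpose (basis_block \<phi> \<alpha> z) ** Yk z ** basis_block \<phi> \<beta> z)))"

definition quadrature_ibp :: "'d::finite element \<Rightarrow> nat \<Rightarrow> (real^'d) quadrature \<Rightarrow>
    ((real^'d) set \<Rightarrow> (real^'d) quadrature) \<Rightarrow> (real^'d \<Rightarrow> real^'m^'m::finite) \<Rightarrow> 'd \<Rightarrow> bool" where
  "quadrature_ibp E p Q QF Yk k \<longleftrightarrow>
     (\<forall>x\<in>vec_poly_space p. \<forall>y\<in>vec_poly_space p.
        let \<psi> = (\<lambda>z. y z \<bullet> (Yk z *v x z)) in
        quad Q (partial_deriv (region E) k \<psi>) = face_quad E QF (\<lambda>F z. \<psi> z * normal E F z $ k))"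

definition symmetric_at_nodes :: "'a quadrature \<Rightarrow> ('a \<Rightarrow> real^'m^'m) \<Rightarrow> bool" where
  "symmetric_at_nodes Q Yk \<longleftrightarrow> (\<forall>z\<in>nodes Q. transpose (Yk z) = Yk z)"

end

theory Submission imports Defs begin

text \<open>The identity is the product rule, tested on the polynomial fields
  \<open>x = \<phi>\<^sub>\<beta> e\<^sub>j\<close> and \<open>y = \<phi>\<^sub>\<alpha> e\<^sub>i\<close>. For these, the scalar \<open>\<psi> = y \<bullet> Y\<^sub>k x\<close> is
  \<open>\<phi>\<^sub>\<alpha> (Y\<^sub>k)\<^sub>i\<^sub>j \<phi>\<^sub>\<beta>\<close>, so that the face side of the discrete integration by parts formula is entry
  \<open>(i, j)\<close> of block \<open>(\<alpha>, \<beta>)\<close> of \<open>B\<close>. On the volume side, differentiating \<open>\<psi>\<close> gives one term for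
  each factor: the derivative of \<open>\<phi>\<^sub>\<beta>\<close> yields the entry of \<open>N\<close>, that of \<open>Y\<^sub>k\<close> the entry of \<open>V\<close>, and
  that of \<open>\<phi>\<^sub>\<alpha>\<close> yields \<open>Q[\<phi>\<^sub>\<beta> (Y\<^sub>k)\<^sub>i\<^sub>j \<partial>\<^sub>k\<phi>\<^sub>\<alpha>]\<close>. The transpose of \<open>N\<close> has \<open>(Y\<^sub>k)\<^sub>j\<^sub>i\<close> in its place; the
  symmetry of \<open>Y\<^sub>k\<close> at the volume nodes identifies the two.

  The product rule needs care at nodes on the boundary of the element, where the derivative within
  the element is a choice among all linear maps that approximate the function to first order. The
  interior cone condition leaves only one such map
  (\<open>has_derivative_unique_interior_cone\<close>), after which the usual rules of differentiation apply
  (\<open>partial_deriv_triple_product\<close>). The statement for the sums over \<open>k\<close> follows because transposition of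
  block matrices is additive.\<close>

section \<open>Derivatives within a set that satisfies the interior cone condition\<close>

lemma has_derivative_unique_on_segment:
  fixes f :: "real^'d \<Rightarrow> 'b::real_normed_vector"
  assumes D1: "(f has_derivative D1) (at z within S)" and D2: "(f has_derivative D2) (at z within S)"
    and T: "0 < T" and sub: "\<And>t. t \<in> {0..T} \<Longrightarrow> z + t *\<^sub>R w \<in> S"
  shows "D1 w = D2 w"
proof -
  let ?g = "\<lambda>t::real. z + t *\<^sub>R w"
  have der: "((\<lambda>t. f (?g t)) has_vector_derivative D w) (at 0 within {0..T})"
    if D: "(f has_derivative D) (at z within S)" for D
  proof -
    have "(f has_derivative D) (at (?g 0) within ?g ` {0..T})"
    proof (rule has_derivative_subset)
      show "(f has_derivative D) (at (?g 0) within S)"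
        using D by simp
      show "?g ` {0..T} \<subseteq> S"
        using sub by blast
    qed
    moreover have "(?g has_derivative (\<lambda>t. t *\<^sub>R w)) (at 0 within {0..T})"
      by (auto intro!: derivative_eq_intros)
    ultimately have "((\<lambda>t. f (?g t)) has_derivative (\<lambda>t. D (t *\<^sub>R w))) (at 0 within {0..T})"
      using diff_chain_within[of ?g "\<lambda>t. t *\<^sub>R w" 0 "{0..T}" f D] by (simp add: o_def)
    moreover have "D (t *\<^sub>R w) = t *\<^sub>R D w" for t
      using has_derivative_linear[OF D] by (simp add: linear_scale)
    ultimately show ?thesis
      by (simp add: has_vector_derivative_def)
  qed
  show ?thesis
  proof (rule vector_derivative_unique_within)
    show "at 0 within {0..T} \<noteq> bot"
      using T by (simp add: trivial_limit_within islimpt_Icc)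
  qed (rule der[OF D1], rule der[OF D2])
qed

text \<open>Two derivatives agree along every ray of the cone; the directions of these rays fill a ball,
  and a linear map that vanishes on a ball is zero. Without uniqueness, the choice made by
  \<^const>\<open>frechet_derivative\<close> at a node on the boundary need not obey the product rule.\<close>

lemma has_derivative_unique_interior_cone:
  fixes f :: "real^'d::finite \<Rightarrow> 'b::real_normed_vector"
  assumes S: "interior_cone_condition S" and z: "z \<in> S"
    and D1: "(f has_derivative D1) (at z within S)" and D2: "(f has_derivative D2) (at z within S)"
  shows "D1 = D2"
proof
  fix u :: "real^'d"
  obtain v r T where rT: "0 < r" "0 < T"
    and cone: "\<And>w t. w \<in> ball v r \<Longrightarrow> t \<in> {0<..T} \<Longrightarrow> z + t *\<^sub>R w \<in> S"
    using S z unfolding interior_cone_condition_def by blast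
  have eq: "D1 w = D2 w" if "w \<in> ball v r" for w
  proof (rule has_derivative_unique_on_segment[OF D1 D2 \<open>0 < T\<close>])
    show "z + t *\<^sub>R w \<in> S" if "t \<in> {0..T}" for t
      using that cone[OF \<open>w \<in> ball v r\<close>, of t] z by (cases "t = 0") auto
  qed
  \<comment> \<open>The perturbation \<open>s u\<close> of \<open>v\<close> stays in the ball; adding 1 to the norm covers \<open>u = 0\<close>.\<close>
  define s where "s = r / 2 / (norm u + 1)"
  have pos: "norm u + 1 > 0"
    by (simp add: add_nonneg_pos)
  then have "s > 0"
    using rT by (simp add: s_def)
  then have "s * norm u \<le> s * (norm u + 1)"
    by simp
  also have "s * (norm u + 1) = r / 2"
    using nonzero_eq_divide_eq[of "norm u + 1" s "r / 2"] pos s_def by linarith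
  finally have "s * norm u < r"
    using rT by simp
  then have "v + s *\<^sub>R u \<in> ball v r"
    using \<open>s > 0\<close> by (simp add: dist_norm)
  then have "D1 (v + s *\<^sub>R u) = D2 (v + s *\<^sub>R u)" "D1 v = D2 v"
    using eq rT by simp_all
  then have "s *\<^sub>R D1 u = s *\<^sub>R D2 u"
    using has_derivative_linear[OF D1] has_derivative_linear[OF D2]
    by (simp add: linear_add linear_scale)
  then show "D1 u = D2 u"
    using \<open>s > 0\<close> by simp
qed

lemma partial_deriv_eqI:
  fixes f :: "real^'d::finite \<Rightarrow> 'b::real_normed_vector"
  assumes "interior_cone_condition S" "z \<in> S" "(f has_derivative D) (at z within S)"
  shows "partial_deriv S k f z = D (axis k 1)"
proof -
  have "(f has_derivative frechet_derivative f (at z within S)) (at z within S)"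
    using assms(3) frechet_derivative_works differentiable_def by blast
  then show ?thesis
    using has_derivative_unique_interior_cone[OF assms(1,2) _ assms(3)]
    by (simp add: partial_deriv_def)
qed

lemma partial_deriv_basis_block:
  fixes \<phi> :: "'n \<Rightarrow> real^'d::finite \<Rightarrow> real"
  assumes S: "interior_cone_condition S" "z \<in> S" and f: "\<phi> \<alpha> differentiable at z within S"
  shows "partial_deriv S k (basis_block \<phi> \<alpha> :: _ \<Rightarrow> real^'m^'m::finite) z
         = partial_deriv S k (\<phi> \<alpha>) z *\<^sub>R mat 1"
proof -
  obtain D where D: "(\<phi> \<alpha> has_derivative D) (at z within S)"
    using f by (auto simp: differentiable_def)
  have block: "basis_block \<phi> \<alpha> = (\<lambda>z. \<phi> \<alpha> z *\<^sub>R (mat 1 :: real^'m^'m))"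
    by (rule ext) (rule basis_block_def)
  have "((\<lambda>z. \<phi> \<alpha> z *\<^sub>R (mat 1 :: real^'m^'m)) has_derivative (\<lambda>h. D h *\<^sub>R mat 1)) (at z within S)"
    by (rule has_derivative_scaleR_left[OF D])
  from partial_deriv_eqI[OF S this] show ?thesis
    unfolding block partial_deriv_eqI[OF S D] .
qed

text \<open>The three terms are written as they appear in the entries of \<open>N\<close>, of the transpose of \<open>N\<close> (up to
  exchanging \<open>i\<close> and \<open>j\<close> in \<open>Y\<close>), and of \<open>V\<close>.\<close>

lemma partial_deriv_triple_product:
  fixes f g :: "real^'d::finite \<Rightarrow> real" and Y :: "real^'d \<Rightarrow> real^'m^'m::finite"
  assumes S: "interior_cone_condition S" "z \<in> S"
    and f: "f differentiable at z within S" and g: "g differentiable at z within S"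
    and Y: "Y differentiable at z within S"
  shows "partial_deriv S k (\<lambda>z. f z * Y z $ i $ j * g z) z
         = f z * Y z $ i $ j * partial_deriv S k g z
         + g z * Y z $ i $ j * partial_deriv S k f z
         + f z * partial_deriv S k Y z $ i $ j * g z"
proof -
  obtain Df Dg DY where D: "(f has_derivative Df) (at z within S)"
    "(g has_derivative Dg) (at z within S)" "(Y has_derivative DY) (at z within S)"
    using f g Y by (auto simp: differentiable_def)
  have "((\<lambda>z. Y z $ i $ j) has_derivative (\<lambda>h. DY h $ i $ j)) (at z within S)"
    by (intro bounded_linear.has_derivative[OF bounded_linear_vec_nth] D)
  then have "((\<lambda>z. f z * Y z $ i $ j * g z) has_derivative
      (\<lambda>h. f z * Y z $ i $ j * Dg h + (f z * DY h $ i $ j + Df h * Y z $ i $ j) * g z))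
      (at z within S)"
    by (intro has_derivative_mult D)
  from partial_deriv_eqI[OF S this] partial_deriv_eqI[OF S D(1)] partial_deriv_eqI[OF S D(2)]
    partial_deriv_eqI[OF S D(3)]
  show ?thesis by (simp add: algebra_simps)
qed

section \<open>Polynomial test functions\<close>

lemma poly_space_differentiable:
  assumes "f \<in> poly_space p"
  shows "f differentiable at z within S"
proof -
  obtain c :: "('a \<Rightarrow> nat) \<Rightarrow> real" where
    f: "f = (\<lambda>z. \<Sum>a | sum a UNIV \<le> p. c a * (\<Prod>i\<in>UNIV. (z $ i) ^ a i))"
    using assms by (auto simp: poly_space_def)
  have "(\<lambda>z::real^'a. z $ i) differentiable at z within S" for i
    by (simp add: bounded_linear_imp_differentiable bounded_linear_vec_nth)
  then have "(\<lambda>z::real^'a. (z $ i) ^ n) differentiable at z within S" for i n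
    by (intro differentiable_power)
  then obtain D where "((\<lambda>z::real^'a. (z $ i) ^ n) has_derivative D i n) (at z within S)" for i n
    unfolding differentiable_def by metis
  then have "(\<lambda>z::real^'a. \<Prod>i\<in>UNIV. (z $ i) ^ a i) differentiable at z within S" for a
    by (intro differentiableI[OF has_derivative_prod])
  then have "(\<lambda>z::real^'a. c a * (\<Prod>i\<in>UNIV. (z $ i) ^ a i)) differentiable at z within S" for a
    by (intro differentiable_mult) auto
  then show ?thesis
    unfolding f by (cases "finite {a::'a \<Rightarrow> nat. sum a UNIV \<le> p}") (auto intro: differentiable_sum)
qed

lemma scaleR_axis_in_vec_poly_space:
  assumes "f \<in> poly_space p"
  shows "(\<lambda>z. f z *\<^sub>R axis j 1) \<in> vec_poly_space p"
proof -
  have "(\<lambda>z. 0) \<in> poly_space p"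
    unfolding poly_space_def by (intro CollectI exI[of _ "\<lambda>_. 0"]) simp
  then have "(\<lambda>z. (f z *\<^sub>R axis j 1) $ i) \<in> poly_space p" for i
    using assms by (cases "i = j") (simp_all add: axis_def)
  then show ?thesis by (simp add: vec_poly_space_def)
qed

section \<open>Entries of the block matrices\<close>

text \<open>Blocks of the form \<open>\<phi> I\<close> act as scalars, so each entry of a block matrix is a quadrature of
  products of real functions.\<close>

lemma scaled_identity_mult:
  fixes A :: "real^'m^'m::finite"
  shows "transpose (a *\<^sub>R mat 1) ** A ** (b *\<^sub>R mat 1) = (a * b) *\<^sub>R A"
  by (simp add: vec_eq_iff matrix_matrix_mult_def mat_def transpose_def if_distrib if_distribR
      sum.delta sum.delta' cong: if_cong)

lemma quad_nth: "quad Q f $ i = quad Q (\<lambda>z. f z $ i)"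
  by (simp add: quad_def)

lemma face_quad_nth: "face_quad E QF g $ i = face_quad E QF (\<lambda>F z. g F z $ i)"
  by (simp add: face_quad_def quad_nth)

lemma quad_add: "quad Q (\<lambda>z. f z + g z) = quad Q f + quad Q g"
  by (simp add: quad_def scaleR_add_right sum.distrib)

lemma quad_cong: "(\<And>z. z \<in> nodes Q \<Longrightarrow> f z = g z) \<Longrightarrow> quad Q f = quad Q g"
  by (simp add: quad_def)

lemma N_mat_nth:
  fixes \<phi> :: "'n::finite \<Rightarrow> real^'d::finite \<Rightarrow> real" and Yk :: "real^'d \<Rightarrow> real^'m^'m::finite"
  assumes "interior_cone_condition (region E)" "nodes Q \<subseteq> region E"
    and "\<And>z. \<phi> \<beta> differentiable at z within region E"
  shows "N_mat E Q \<phi> Yk k $ \<alpha> $ \<beta> $ i $ j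
         = quad Q (\<lambda>z. \<phi> \<alpha> z * Yk z $ i $ j * partial_deriv (region E) k (\<phi> \<beta>) z)"
  unfolding N_mat_def vec_lambda_beta quad_nth
proof (rule quad_cong)
  fix z assume "z \<in> nodes Q"
  then have "partial_deriv (region E) k (basis_block \<phi> \<beta>) z
             = partial_deriv (region E) k (\<phi> \<beta>) z *\<^sub>R (mat 1 :: real^'m^'m)"
    using assms by (intro partial_deriv_basis_block) auto
  then show "(transpose (basis_block \<phi> \<alpha> z) ** Yk z **
        partial_deriv (region E) k (basis_block \<phi> \<beta>) z) $ i $ j
      = \<phi> \<alpha> z * Yk z $ i $ j * partial_deriv (region E) k (\<phi> \<beta>) z"
    by (simp add: basis_block_def scaled_identity_mult)
qed

lemma V_mat_nth:
  "V_mat E Q \<phi> Yk k $ \<alpha> $ \<beta> $ i $ j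
   = quad Q (\<lambda>z. \<phi> \<alpha> z * partial_deriv (region E) k Yk z $ i $ j * \<phi> \<beta> z)"
  by (simp add: V_mat_def quad_nth basis_block_def scaled_identity_mult mult_ac)

lemma B_mat_nth:
  "B_mat E QF \<phi> Yk k $ \<alpha> $ \<beta> $ i $ j
   = face_quad E QF (\<lambda>F z. (\<phi> \<alpha> z * Yk z $ i $ j * \<phi> \<beta> z) * normal E F z $ k)"
  by (simp add: B_mat_def face_quad_nth basis_block_def scaled_identity_mult mult_ac)

lemma block_transpose_nth: "block_transpose X $ \<alpha> $ \<beta> $ i $ j = X $ \<beta> $ \<alpha> $ j $ i"
  by (simp add: block_transpose_def transpose_def)

lemma block_transpose_sum: "block_transpose (\<Sum>k\<in>A. X k) = (\<Sum>k\<in>A. block_transpose (X k))"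
  by (simp add: vec_eq_iff block_transpose_nth)

section \<open>The summation-by-parts identity\<close>

text \<open>The hypothesis is scalar and the conclusion sought is an identity of matrices; coordinate
  vector fields, scaled by polynomials, extract the individual entries.\<close>

lemma quadrature_ibp_entry:
  fixes f g :: "real^'d::finite \<Rightarrow> real"
  assumes "quadrature_ibp E p Q QF Yk k" "f \<in> poly_space p" "g \<in> poly_space p"
  shows "quad Q (partial_deriv (region E) k (\<lambda>z. f z * Yk z $ i $ j * g z))
         = face_quad E QF (\<lambda>F z. (f z * Yk z $ i $ j * g z) * normal E F z $ k)"
proof -
  have "f z *\<^sub>R axis i 1 \<bullet> (Yk z *v (g z *\<^sub>R axis j 1)) = f z * Yk z $ i $ j * g z" for z
    by (simp add: matrix_vector_mult_scaleR matrix_vector_mul_component inner_axis' column_def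
      matrix_vector_mult_basis)
  note \<psi> = this
  show ?thesis
    using assms(1)[unfolded quadrature_ibp_def Let_def, rule_format,
      OF scaleR_axis_in_vec_poly_space[OF assms(3), of j] scaleR_axis_in_vec_poly_space[OF assms(2), of i]]
    unfolding \<psi> .
qed

lemma H_SBP_direction:
  fixes E :: "'d::finite element" and \<phi> :: "'n::finite \<Rightarrow> real^'d \<Rightarrow> real"
    and Yk :: "real^'d \<Rightarrow> real^'m^'m::finite"
  assumes cone: "interior_cone_condition (region E)" and Q: "nodes Q \<subseteq> region E"
    and \<phi>: "\<And>\<alpha>. \<phi> \<alpha> \<in> poly_space p"
    and Y: "Yk differentiable_on region E" and ibp: "quadrature_ibp E p Q QF Yk k"
    and sym: "symmetric_at_nodes Q Yk"
  shows "N_mat E Q \<phi> Yk k + block_transpose (N_mat E Q \<phi> Yk k)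
         = B_mat E QF \<phi> Yk k - V_mat E Q \<phi> Yk k"
proof -
  have entry: "N_mat E Q \<phi> Yk k $ \<alpha> $ \<beta> $ i $ j + N_mat E Q \<phi> Yk k $ \<beta> $ \<alpha> $ j $ i
      + V_mat E Q \<phi> Yk k $ \<alpha> $ \<beta> $ i $ j = B_mat E QF \<phi> Yk k $ \<alpha> $ \<beta> $ i $ j" for \<alpha> \<beta> i j
  proof -
    let ?d = "partial_deriv (region E) k"
    have diff: "\<phi> \<gamma> differentiable at z within region E" for \<gamma> z
      by (rule poly_space_differentiable[OF \<phi>])
    have pd: "?d (\<lambda>z. \<phi> \<alpha> z * Yk z $ i $ j * \<phi> \<beta> z) z
          = \<phi> \<alpha> z * Yk z $ i $ j * ?d (\<phi> \<beta>) z + \<phi> \<beta> z * Yk z $ j $ i * ?d (\<phi> \<alpha>) z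
          + \<phi> \<alpha> z * ?d Yk z $ i $ j * \<phi> \<beta> z" if z: "z \<in> nodes Q" for z
    proof -
      have "transpose (Yk z) $ i $ j = Yk z $ i $ j"
        using sym z by (simp add: symmetric_at_nodes_def)
      then have sym_ij: "Yk z $ j $ i = Yk z $ i $ j"
        by (simp add: transpose_def)
      have "z \<in> region E" using Q z by auto
      then have "Yk differentiable at z within region E"
        using Y by (simp add: differentiable_on_def)
      then show ?thesis
        unfolding sym_ij by (rule partial_deriv_triple_product[OF cone \<open>z \<in> region E\<close> diff diff])
    qed
    have "B_mat E QF \<phi> Yk k $ \<alpha> $ \<beta> $ i $ j
        = quad Q (?d (\<lambda>z. \<phi> \<alpha> z * Yk z $ i $ j * \<phi> \<beta> z))"
      unfolding B_mat_nth by (rule quadrature_ibp_entry[OF ibp \<phi> \<phi>, symmetric])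
    also have "\<dots> = quad Q (\<lambda>z. \<phi> \<alpha> z * Yk z $ i $ j * ?d (\<phi> \<beta>) z
        + \<phi> \<beta> z * Yk z $ j $ i * ?d (\<phi> \<alpha>) z + \<phi> \<alpha> z * ?d Yk z $ i $ j * \<phi> \<beta> z)"
      by (rule quad_cong) (rule pd)
    also have "\<dots> = N_mat E Q \<phi> Yk k $ \<alpha> $ \<beta> $ i $ j + N_mat E Q \<phi> Yk k $ \<beta> $ \<alpha> $ j $ i
        + V_mat E Q \<phi> Yk k $ \<alpha> $ \<beta> $ i $ j"
      by (simp add: quad_add N_mat_nth[OF cone Q diff] V_mat_nth)
    finally show ?thesis by simp
  qed
  then show ?thesis
    by (simp add: vec_eq_iff block_transpose_nth eq_diff_eq)
qed

theorem proposition5p4: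
  fixes E :: "'d::finite element"
    and p :: nat
    and \<phi> :: "'n::finite \<Rightarrow> real^'d \<Rightarrow> real"
    and Q :: "(real^'d) quadrature"
    and QF :: "(real^'d) set \<Rightarrow> (real^'d) quadrature"
    and Y :: "'d \<Rightarrow> real^'d \<Rightarrow> real^'m^'m::finite"
  assumes "is_element E"
    and "L2_orthonormal_basis (region E) p \<phi>"
    and "quadrature_on (region E) Q"
    and "face_quadrature_on E QF"
  shows "(\<forall>k. Y k differentiable_on region E \<and> quadrature_ibp E p Q QF (Y k) k \<and>
              symmetric_at_nodes Q (Y k) \<longrightarrow>
            N_mat E Q \<phi> (Y k) k + block_transpose (N_mat E Q \<phi> (Y k) k) =
            B_mat E QF \<phi> (Y k) k - V_mat E Q \<phi> (Y k) k) \<and>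
         ((\<forall>k. Y k differentiable_on region E \<and> quadrature_ibp E p Q QF (Y k) k \<and>
              symmetric_at_nodes Q (Y k)) \<longrightarrow>
            (let N = (\<Sum>k\<in>UNIV. N_mat E Q \<phi> (Y k) k);
                 V = (\<Sum>k\<in>UNIV. V_mat E Q \<phi> (Y k) k);
                 B = (\<Sum>k\<in>UNIV. B_mat E QF \<phi> (Y k) k)
             in N + block_transpose N = B - V))"
proof -
  have cone: "interior_cone_condition (region E)"
    using assms(1) by (simp add: is_element_def)
  have Q: "nodes Q \<subseteq> region E"
    using assms(3) by (simp add: quadrature_on_def)
  have \<phi>: "\<phi> \<alpha> \<in> poly_space p" for \<alpha>
    using assms(2) by (simp add: L2_orthonormal_basis_def)
  note direction = H_SBP_direction[OF cone Q \<phi>]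
  show ?thesis
    unfolding Let_def block_transpose_sum sum.distrib[symmetric] sum_subtractf[symmetric]
    by (intro conjI allI impI sum.cong direction) auto
qed

end
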